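(* Let $N\ge 1$ be an integer. Then $$\sup\left\{\frac{|\mathrm{perm}[\vec f_1,\dots,\vec f_N]|}{\prod_{j=1}^N|\vec f_j|_1}\ :\ \vec f_1,\dots,\vec f_N\in\mathbb{C}^N\setminus\{0\}\right\}=1 .$$
   Context: For $\vec f\in\mathbb{C}^N$ with entries $(\vec f)_k$, $|\vec f|_1=\sum_{k=1}^N|(\vec f)_k|$. $[\vec f_1,\dots,\vec f_N]$ denotes the $N\times N$ matrix whose $j$th column is $\vec f_j$. The permanent of an $N\times N$ matrix $F=(F_{i,j})$ is $\mathrm{perm}(F)=\sum_\sigma\prod_{j=1}^N F_{\sigma(j),j}$, the sum being over all permutations $\sigma$ of $\{1,\dots,N\}$. *)

theory Defs
  imports "HOL-Analysis.Analysis"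
begin

definition l1_norm :: "complex ^ 'n \<Rightarrow> real"
  where "l1_norm x = (\<Sum>k\<in>UNIV. cmod (x $ k))"

(* The family f is indexed by columns; f j is the j-th column. *)
definition of_columns :: "('n \<Rightarrow> 'a ^ 'm) \<Rightarrow> 'a ^ 'n ^ 'm"
  where "of_columns f = (\<chi> i j. f j $ i)"

definition permanent :: "'a::comm_semiring_1 ^ 'n ^ 'n \<Rightarrow> 'a"
  where "permanent A = (\<Sum>p | p permutes (UNIV :: 'n set). \<Prod>j\<in>UNIV. A $ p j $ j)"

end

theory Submission
  imports Defs
begin

text \<open>
  Expanding the product of the column norms gives a sum of
  \<open>\<Prod>j. \<bar>f j $ g j\<bar>\<close> over all self-maps \<open>g\<close> of the index set. The permanent is the
  corresponding sum without absolute values, taken only over the bijective \<open>g\<close>, so the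
  triangle inequality, followed by adding the nonnegative terms for the remaining maps, bounds
  every quotient by 1 (\<open>cmod_permanent_le_prod_l1_norm\<close>). The standard basis vectors are the
  columns of the identity matrix, whose permanent is 1 (\<open>permanent_mat_1\<close>); hence the bound is
  attained and the supremum is a maximum.
\<close>

text \<open>The right-hand side is the sum of the same products over all self-maps of the index set,
  of which the permutations are a part.\<close>
lemma cmod_permanent_le_prod_l1_norm:
  fixes f :: "'n::finite \<Rightarrow> complex ^ 'n"
  shows "cmod (permanent (of_columns f)) \<le> (\<Prod>j\<in>UNIV. l1_norm (f j))"
proof -
  have "cmod (permanent (of_columns f))
      = cmod (\<Sum>p | p permutes (UNIV :: 'n set). \<Prod>j\<in>UNIV. f j $ p j)"
    by (simp add: permanent_def of_columns_def)
  also have "\<dots> \<le> (\<Sum>p | p permutes (UNIV :: 'n set). \<Prod>j\<in>UNIV. cmod (f j $ p j))"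
    unfolding prod_norm by (rule norm_sum)
  also have "\<dots> \<le> (\<Sum>g\<in>(UNIV :: ('n \<Rightarrow> 'n) set). \<Prod>j\<in>UNIV. cmod (f j $ g j))"
    by (rule sum_mono2) (auto intro: prod_nonneg)
  also have "\<dots> = (\<Prod>j\<in>UNIV. l1_norm (f j))"
    by (simp add: l1_norm_def prod_sum_PiE)
  finally show ?thesis .
qed

lemma l1_norm_eq_0_iff [simp]: "l1_norm x = 0 \<longleftrightarrow> x = 0"
  by (simp add: l1_norm_def sum_nonneg_eq_0_iff vec_eq_iff)

lemma l1_norm_nonneg: "0 \<le> l1_norm x"
  by (simp add: l1_norm_def sum_nonneg)

lemma l1_norm_axis: "l1_norm (axis i c) = cmod c"
proof -
  have "l1_norm (axis i c) = (\<Sum>k\<in>UNIV. if k = i then cmod c else 0)"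
    unfolding l1_norm_def by (rule sum.cong) (auto simp: axis_def)
  then show ?thesis by simp
qed

lemma of_columns_axis: "of_columns (\<lambda>j. axis j 1) = mat 1"
  by (auto simp: of_columns_def mat_def axis_def vec_eq_iff)

text \<open>A permutation other than the identity moves some index and so meets an off-diagonal zero.\<close>
lemma permanent_mat_1: "permanent (mat 1 :: 'a::comm_semiring_1 ^ 'n::finite ^ 'n) = 1"
proof -
  have zero: "(\<Prod>j\<in>UNIV. (mat 1 :: 'a ^ 'n ^ 'n) $ p j $ j) = 0" if "p \<noteq> id" for p
  proof -
    obtain j where "p j \<noteq> j" using \<open>p \<noteq> id\<close> by (auto simp: fun_eq_iff)
    then show ?thesis by (intro prod_zero) (auto simp: mat_def)
  qed
  have "permanent (mat 1 :: 'a ^ 'n ^ 'n)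
      = (\<Sum>p\<in>{id}. \<Prod>j\<in>UNIV. (mat 1 :: 'a ^ 'n ^ 'n) $ p j $ j)"
    unfolding permanent_def
    by (rule sum.mono_neutral_right) (auto simp: permutes_id zero)
  also have "\<dots> = 1" by (simp add: mat_def)
  finally show ?thesis .
qed

theorem mainTheorem3:
  fixes S :: "real set"
  assumes "S = {cmod (permanent (of_columns f)) / (\<Prod>j\<in>UNIV. l1_norm (f j)) | f :: 'n::finite \<Rightarrow> complex ^ 'n. \<forall>j. f j \<noteq> 0}"
  shows "bdd_above S \<and> Sup S = 1"
proof -
  have upper: "x \<le> 1" if x: "x \<in> S" for x
  proof -
    from x obtain f :: "'n \<Rightarrow> complex ^ 'n" where f: "\<forall>j. f j \<noteq> 0"
      and x_eq: "x = cmod (permanent (of_columns f)) / (\<Prod>j\<in>UNIV. l1_norm (f j))"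
      unfolding assms by blast
    have "0 < l1_norm (f j)" for j
      using f l1_norm_nonneg[of "f j"] by (simp add: order_less_le)
    then have "0 < (\<Prod>j\<in>UNIV. l1_norm (f j))" by (simp add: prod_pos)
    then show ?thesis
      using cmod_permanent_le_prod_l1_norm[of f] by (simp add: x_eq)
  qed
  have attained: "1 \<in> S"
    unfolding assms
    by (rule CollectI, rule exI[of _ "\<lambda>j. axis j 1"])
       (simp add: of_columns_axis permanent_mat_1 l1_norm_axis axis_eq_0_iff)
  show ?thesis
  proof
    show "bdd_above S" using upper by (rule bdd_aboveI)
    show "Sup S = 1" using attained upper by (rule cSup_eq_maximum)
  qed
qed

end
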